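(* Let $X$ and $Y$ be two extremally disconnected compact Hausdorff spaces, $(cX,c)$ be an arbitrary C-semiregular extension of $X$ and $f:X\to Y$ be a continuous map. Then there exists a continuous map $f':cX\to\gamma Y$ such that $\gamma_Y\circ f=f'\circ c$. In particular, for every continuous map $f:X\to Y$ there exists a continuous map $\gamma f:\gamma X\to\gamma Y$ such that $\gamma_Y\circ f=\gamma f\circ\gamma_X$.
   Context: A space is extremally disconnected if the closure of every open set is open. For a space $Z$, $RC(Z)$ is the Boolean algebra of regular closed subsets ($F=\mathrm{cl}(\mathrm{int}F)$) with $a+b=a\cup b$, $a^*=\mathrm{cl}(Z\setminus a)$, $a\cdot b=\mathrm{cl}(\mathrm{int}(a\cap b))$, $0=\emptyset$, $1=Z$. For $z\in Z$, $\sigma_z=\{F\in RC(Z)\mid z\in F\}$; $Z$ is semiregular if $RC(Z)$ is a closed base for $Z$. A grill of a Boolean algebra $B$ is a non-empty $\Gamma\subseteq B$ such that $0\notin\Gamma$; $a\in\Gamma$, $a\le b$ imply $b\in\Gamma$; and $a+b\in\Gamma$ implies $a\in\Gamma$ or $b\in\Gamma$. A semiregular $T_0$-space $Z$ is C-semiregular if for every grill $\Gamma$ of $RC(Z)$ such that $F\cap G\neq\emptyset$ for all $F,G\in\Gamma$ there is $z\in Z$ with $\Gamma=\sigma_z$. An extension of a space $Y$ is a pair $(Z,f)$ with $f:Y\to Z$ a dense embedding; it is C-semiregular if $Z$ is. Two extensions $(Z_1,f_1),(Z_2,f_2)$ are equivalent if there is a homeomorphism $\varphi:Z_1\to Z_2$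 with $\varphi\circ f_1=f_2$. For equivalence classes, $[(Z_1,f_1)]\le_{in}[(Z_2,f_2)]$ iff there is a continuous map $h:Z_1\to Z_2$ with $h\circ f_1=f_2$ which is a homeomorphism of $Z_1$ onto the subspace $h(Z_1)$. For every extremally disconnected compact Hausdorff space $Y$, the set of equivalence classes of C-semiregular extensions of $Y$, ordered by $\le_{in}$, has a largest element; $(\gamma Y,\gamma_Y)$ denotes a C-semiregular extension representing it. Concretely, $\gamma Y$ can be taken as the set of all grills of $RC(Y)$ with the closed base $\{\{\Gamma\mid F\in\Gamma\}\mid F\in RC(Y)\}$, and $\gamma_Y(y)=\{F\in RC(Y)\mid y\in F\}$. *)

theory Defs
  imports "HOL-Analysis.Analysis"
begin

definition extremally_disconnected_space :: "'a topology \<Rightarrow> bool" where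
  "extremally_disconnected_space X \<longleftrightarrow> (\<forall>U. openin X U \<longrightarrow> openin X (X closure_of U))"

definition RC :: "'a topology \<Rightarrow> 'a set set" where
  "RC X = {F. F \<subseteq> topspace X \<and> X closure_of (X interior_of F) = F}"

definition closed_base_of :: "'a topology \<Rightarrow> 'a set set \<Rightarrow> bool" where
  "closed_base_of X \<B> \<longleftrightarrow>
     (\<forall>F\<in>\<B>. closedin X F) \<and>
     (\<forall>C. closedin X C \<longrightarrow> (\<exists>\<A>\<subseteq>\<B>. C = topspace X \<inter> \<Inter>\<A>))"

definition semiregular_space :: "'a topology \<Rightarrow> bool" where
  "semiregular_space X \<longleftrightarrow> closed_base_of X (RC X)"

text \<open>Grills of the Boolean algebra \<open>RC X\<close>, whose zero is the empty set, whose join is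
  binary union and whose order is therefore inclusion.\<close>

definition grill_RC :: "'a topology \<Rightarrow> 'a set set \<Rightarrow> bool" where
  "grill_RC X \<Gamma> \<longleftrightarrow>
     \<Gamma> \<subseteq> RC X \<and> \<Gamma> \<noteq> {} \<and> {} \<notin> \<Gamma> \<and>
     (\<forall>a\<in>\<Gamma>. \<forall>b\<in>RC X. a \<subseteq> b \<longrightarrow> b \<in> \<Gamma>) \<and>
     (\<forall>a\<in>RC X. \<forall>b\<in>RC X. a \<union> b \<in> \<Gamma> \<longrightarrow> a \<in> \<Gamma> \<or> b \<in> \<Gamma>)"

definition sigma_RC :: "'a topology \<Rightarrow> 'a \<Rightarrow> 'a set set" where
  "sigma_RC X x = {F \<in> RC X. x \<in> F}"

definition C_semiregular_space :: "'a topology \<Rightarrow> bool" where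
  "C_semiregular_space X \<longleftrightarrow>
     semiregular_space X \<and> t0_space X \<and>
     (\<forall>\<Gamma>. grill_RC X \<Gamma> \<and> (\<forall>F\<in>\<Gamma>. \<forall>G\<in>\<Gamma>. F \<inter> G \<noteq> {})
          \<longrightarrow> (\<exists>x\<in>topspace X. \<Gamma> = sigma_RC X x))"

definition extension_of :: "'a topology \<Rightarrow> 'b topology \<Rightarrow> ('a \<Rightarrow> 'b) \<Rightarrow> bool" where
  "extension_of X Z f \<longleftrightarrow>
     embedding_map X Z f \<and> Z closure_of (f ` topspace X) = topspace Z"

definition C_semiregular_extension :: "'a topology \<Rightarrow> 'b topology \<Rightarrow> ('a \<Rightarrow> 'b) \<Rightarrow> bool" where
  "C_semiregular_extension X Z f \<longleftrightarrow> extension_of X Z f \<and> C_semiregular_space Z"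

text \<open>The preorder on extensions that induces the order on equivalence classes of extensions.\<close>

definition ext_le_in ::
  "'a topology \<Rightarrow> 'b topology \<Rightarrow> ('a \<Rightarrow> 'b) \<Rightarrow> 'c topology \<Rightarrow> ('a \<Rightarrow> 'c) \<Rightarrow> bool" where
  "ext_le_in X Z1 f1 Z2 f2 \<longleftrightarrow>
     (\<exists>h. embedding_map Z1 Z2 h \<and> (\<forall>x\<in>topspace X. h (f1 x) = f2 x))"

text \<open>\<open>is_gamma X Z j\<close>: the pair \<open>(Z, j)\<close> represents the largest equivalence class of
  C-semiregular extensions of \<open>X\<close>, that is, \<open>(Z, j)\<close> may serve as the extension gamma of \<open>X\<close>.
  The competing extensions range over spaces with points in \<^typ>\<open>'a set set\<close>. This is no
  restriction: a point of a semiregular T0 extension is determined by a family of regular closed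
  subsets of \<open>X\<close>, so up to equivalence every such extension lives on this type. See
  \<open>is_gamma_largest\<close> (any carrier type) and \<open>is_gamma_grills\<close> (existence) below.\<close>

definition is_gamma :: "'a topology \<Rightarrow> 'b topology \<Rightarrow> ('a \<Rightarrow> 'b) \<Rightarrow> bool" where
  "is_gamma X Z j \<longleftrightarrow>
     C_semiregular_extension X Z j \<and>
     (\<forall>(W :: 'a set set topology) h. C_semiregular_extension X W h \<longrightarrow> ext_le_in X W h Z j)"


text \<open>The concrete model on the set of all grills. The complements of the generating open sets
  form the closed base: they are closed under binary unions by the last grill condition.\<close>

definition grill_space :: "'a topology \<Rightarrow> 'a set set topology" where
  "grill_space X =
     topology_generated_by ((\<lambda>F. {\<Gamma>. grill_RC X \<Gamma> \<and> F \<notin> \<Gamma>}) ` RC X)"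

lemma RC_closedin: "F \<in> RC X \<Longrightarrow> closedin X F"
  unfolding RC_def by (metis (mono_tags, lifting) closedin_closure_of mem_Collect_eq)

lemma RC_closure_open: "openin X U \<Longrightarrow> X closure_of U \<in> RC X"
  unfolding RC_def mem_Collect_eq
  by (metis closure_of_closure_of closure_of_mono closure_of_subset closure_of_subset_topspace
      interior_of_maximal interior_of_subset openin_subset subset_antisym)

lemma RC_empty: "{} \<in> RC X" and RC_topspace: "topspace X \<in> RC X"
  by (auto simp: RC_def)

lemma RC_Un:
  assumes "F \<in> RC X" "G \<in> RC X"
  shows "F \<union> G \<in> RC X"
proof -
  have "F \<union> G = X closure_of (X interior_of F \<union> X interior_of G)"
    using assms by (simp add: RC_def)
  then show ?thesis
    using RC_closure_open by (metis openin_Un openin_interior_of)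
qed

lemma grill_subset: "grill_RC X \<Gamma> \<Longrightarrow> \<Gamma> \<subseteq> RC X"
  and grill_nonempty: "grill_RC X \<Gamma> \<Longrightarrow> \<exists>a. a \<in> \<Gamma>"
  and grill_empty: "grill_RC X \<Gamma> \<Longrightarrow> {} \<notin> \<Gamma>"
  and grill_up: "\<lbrakk>grill_RC X \<Gamma>; a \<in> \<Gamma>; b \<in> RC X; a \<subseteq> b\<rbrakk> \<Longrightarrow> b \<in> \<Gamma>"
  by (simp_all add: grill_RC_def ex_in_conv)

lemma grill_Un_iff:
  assumes "grill_RC X \<Gamma>" "a \<in> RC X" "b \<in> RC X"
  shows "a \<union> b \<in> \<Gamma> \<longleftrightarrow> a \<in> \<Gamma> \<or> b \<in> \<Gamma>"
proof
  show "a \<union> b \<in> \<Gamma> \<Longrightarrow> a \<in> \<Gamma> \<or> b \<in> \<Gamma>"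
    using assms by (simp add: grill_RC_def)
  show "a \<in> \<Gamma> \<or> b \<in> \<Gamma> \<Longrightarrow> a \<union> b \<in> \<Gamma>"
    using grill_up[OF assms(1) _ RC_Un[OF assms(2,3)]] by (metis Un_upper1 Un_upper2)
qed

lemma grill_topspace:
  assumes "grill_RC X \<Gamma>"
  shows "topspace X \<in> \<Gamma>"
proof -
  obtain a where a: "a \<in> \<Gamma>" "a \<in> RC X"
    using grill_nonempty[OF assms] grill_subset[OF assms] by (meson subsetD)
  then have "a \<subseteq> topspace X" by (simp add: RC_def)
  with a show ?thesis
    using grill_up[OF assms] RC_topspace by metis
qed

lemma topspace_grill_space: "topspace (grill_space X) = {\<Gamma>. grill_RC X \<Gamma>}"
proof -
  have "\<exists>F\<in>RC X. F \<notin> \<Gamma>" if "grill_RC X \<Gamma>" for \<Gamma>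
    using grill_empty[OF that] RC_empty by metis
  then show ?thesis
    unfolding grill_space_def topology_generated_by_topspace by blast
qed

lemma closedin_grill_basic:
  assumes "F \<in> RC X"
  shows "closedin (grill_space X) {\<Gamma>. grill_RC X \<Gamma> \<and> F \<in> \<Gamma>}"
proof -
  have "openin (grill_space X) {\<Gamma>. grill_RC X \<Gamma> \<and> F \<notin> \<Gamma>}"
    unfolding grill_space_def using assms by (intro topology_generated_by_Basis) auto
  moreover have "topspace (grill_space X) - {\<Gamma>. grill_RC X \<Gamma> \<and> F \<in> \<Gamma>}
                 = {\<Gamma>. grill_RC X \<Gamma> \<and> F \<notin> \<Gamma>}"
    by (auto simp: topspace_grill_space)
  ultimately show ?thesis
    by (auto simp: closedin_def topspace_grill_space)
qed

lemma openin_grill_space: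
  assumes "openin (grill_space X) U"
  shows "\<forall>\<Gamma>\<in>U. \<exists>F\<in>RC X. F \<notin> \<Gamma> \<and> {\<Delta>. grill_RC X \<Delta> \<and> F \<notin> \<Delta>} \<subseteq> U"
proof -
  have "generate_topology_on ((\<lambda>F. {\<Gamma>. grill_RC X \<Gamma> \<and> F \<notin> \<Gamma>}) ` RC X) U"
    using assms unfolding grill_space_def by (rule openin_topology_generated_by)
  then show ?thesis
  proof (induction rule: generate_topology_on.induct)
    case Empty
    then show ?case by simp
  next
    case (Int a b)
    show ?case
    proof
      fix \<Gamma> assume \<Gamma>: "\<Gamma> \<in> a \<inter> b"
      then obtain F where F: "F \<in> RC X" "F \<notin> \<Gamma>" "{\<Delta>. grill_RC X \<Delta> \<and> F \<notin> \<Delta>} \<subseteq> a"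
        using Int by blast
      obtain G where G: "G \<in> RC X" "G \<notin> \<Gamma>" "{\<Delta>. grill_RC X \<Delta> \<and> G \<notin> \<Delta>} \<subseteq> b"
        using Int \<Gamma> by blast
      have "a \<subseteq> topspace (grill_space X)"
        using Int(1) unfolding grill_space_def
        by (metis openin_subset openin_topology_generated_by_iff)
      then have gr: "grill_RC X \<Gamma>"
        using \<Gamma> by (auto simp: topspace_grill_space)
      have FG: "F \<union> G \<in> RC X" using F G RC_Un by blast
      have "F \<union> G \<notin> \<Gamma>"
        using grill_Un_iff[OF gr F(1) G(1)] F G by simp
      moreover have "F \<notin> \<Delta> \<and> G \<notin> \<Delta>" if "grill_RC X \<Delta>" "F \<union> G \<notin> \<Delta>" for \<Delta>
        using grill_Un_iff[OF that(1) F(1) G(1)] that(2) by simp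
      ultimately show "\<exists>F\<in>RC X. F \<notin> \<Gamma> \<and> {\<Delta>. grill_RC X \<Delta> \<and> F \<notin> \<Delta>} \<subseteq> a \<inter> b"
        using F(3) G(3) FG by blast
    qed
  next
    case (UN K)
    show ?case
    proof
      fix \<Gamma> assume "\<Gamma> \<in> \<Union>K"
      then obtain k where k: "k \<in> K" "\<Gamma> \<in> k" by blast
      with UN(2) obtain F where "F \<in> RC X" "F \<notin> \<Gamma>" "{\<Delta>. grill_RC X \<Delta> \<and> F \<notin> \<Delta>} \<subseteq> k"
        by meson
      with k(1) show "\<exists>F\<in>RC X. F \<notin> \<Gamma> \<and> {\<Delta>. grill_RC X \<Delta> \<and> F \<notin> \<Delta>} \<subseteq> \<Union>K"
        by (meson Union_upper subset_trans)
    qed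
  next
    case (Basis s)
    then obtain F where "F \<in> RC X" "s = {\<Gamma>. grill_RC X \<Gamma> \<and> F \<notin> \<Gamma>}" by (rule imageE)
    then show ?case by auto
  qed
qed

lemma closedin_grill_space:
  assumes "closedin (grill_space X) C"
  obtains \<A> where "\<A> \<subseteq> RC X" "C = {\<Gamma>. grill_RC X \<Gamma> \<and> \<A> \<subseteq> \<Gamma>}"
proof -
  let ?A = "{F \<in> RC X. \<forall>\<Gamma>\<in>C. F \<in> \<Gamma>}"
  have C: "C \<subseteq> {\<Gamma>. grill_RC X \<Gamma>}"
    using closedin_subset[OF assms] by (simp add: topspace_grill_space)
  have op: "openin (grill_space X) (topspace (grill_space X) - C)"
    using assms by blast
  have "\<Gamma> \<in> C" if gr: "grill_RC X \<Gamma>" and A: "?A \<subseteq> \<Gamma>" for \<Gamma>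
  proof (rule ccontr)
    assume "\<Gamma> \<notin> C"
    then have "\<Gamma> \<in> topspace (grill_space X) - C"
      using gr by (simp add: topspace_grill_space)
    then obtain F where F: "F \<in> RC X" "F \<notin> \<Gamma>"
        and sub: "{\<Delta>. grill_RC X \<Delta> \<and> F \<notin> \<Delta>} \<subseteq> topspace (grill_space X) - C"
      using openin_grill_space[OF op] by blast
    then have "F \<in> ?A" using C by blast
    then show False using A F by blast
  qed
  then have "C = {\<Gamma>. grill_RC X \<Gamma> \<and> ?A \<subseteq> \<Gamma>}" using C by blast
  then show thesis by (intro that[of ?A]) auto
qed

lemma dense_closure_Int:
  assumes "Z closure_of D = topspace Z" "openin Z V"
  shows "Z closure_of (V \<inter> D) = Z closure_of V"
  using closure_of_openin_Int_superset[of Z V D] assms openin_subset by metis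

lemma extension_RC:
  assumes ext: "extension_of Y W h" and A: "A \<in> RC W"
  shows "\<exists>F\<in>RC Y. A = W closure_of (h ` F)"
proof -
  have cont: "continuous_map Y W h"
    using ext unfolding extension_of_def
    by (meson embedding_map_def continuous_map_in_subtopology homeomorphic_imp_continuous_map)
  define U where "U = {y \<in> topspace Y. h y \<in> W interior_of A}"
  have U: "openin Y U"
    unfolding U_def using cont openin_continuous_map_preimage openin_interior_of by blast
  have hU: "h ` U = W interior_of A \<inter> h ` topspace Y"
    unfolding U_def by blast
  have "W closure_of (h ` U) = A"
    using A ext unfolding hU extension_of_def RC_def
    by (simp add: dense_closure_Int)
  moreover have "W closure_of (h ` (Y closure_of U)) = W closure_of (h ` U)"
  proof (rule subset_antisym)
    have "h ` (Y closure_of U) \<subseteq> W closure_of (h ` U)"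
      by (simp add: cont continuous_map_image_closure_subset)
    then show "W closure_of (h ` (Y closure_of U)) \<subseteq> W closure_of (h ` U)"
      by (simp add: closure_of_minimal)
    show "W closure_of (h ` U) \<subseteq> W closure_of (h ` (Y closure_of U))"
      by (simp add: U closure_of_mono closure_of_subset image_mono openin_subset)
  qed
  ultimately show ?thesis
    using RC_closure_open[OF U] by auto
qed

lemma extension_closure_RC:
  assumes ext: "extension_of Y W h" and F: "F \<in> RC Y"
  shows "W closure_of (h ` F) \<in> RC W"
proof -
  have hom: "homeomorphic_map Y (subtopology W (h ` topspace Y)) h"
    using ext unfolding extension_of_def embedding_map_def by blast
  have cont: "continuous_map Y W h"
    using hom continuous_map_in_subtopology homeomorphic_imp_continuous_map by blast
  let ?U = "Y interior_of F"
  have "openin (subtopology W (h ` topspace Y)) (h ` ?U)"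
    using hom by (meson homeomorphic_map_openness openin_interior_of openin_subset)
  then obtain V where V: "openin W V" "h ` ?U = V \<inter> h ` topspace Y"
    by (auto simp: openin_subtopology)
  have "W closure_of (h ` F) = W closure_of (h ` ?U)"
  proof (rule subset_antisym)
    have "h ` F = h ` (Y closure_of ?U)"
      using F by (simp add: RC_def)
    also have "\<dots> \<subseteq> W closure_of (h ` ?U)"
      by (rule continuous_map_image_closure_subset[OF cont])
    finally show "W closure_of (h ` F) \<subseteq> W closure_of (h ` ?U)"
      by (simp add: closure_of_minimal)
    show "W closure_of (h ` ?U) \<subseteq> W closure_of (h ` F)"
      by (simp add: closure_of_mono image_mono interior_of_subset)
  qed
  also have "\<dots> = W closure_of V"
    using V ext by (simp add: dense_closure_Int extension_of_def)
  finally show ?thesis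
    using RC_closure_open[OF V(1)] by simp
qed

lemma extension_trace:
  assumes ext: "extension_of Y W h" and F: "F \<in> RC Y" and y: "y \<in> topspace Y"
  shows "h y \<in> W closure_of (h ` F) \<longleftrightarrow> y \<in> F"
proof -
  have hom: "homeomorphic_map Y (subtopology W (h ` topspace Y)) h"
    using ext unfolding extension_of_def embedding_map_def by blast
  have FY: "F \<subseteq> topspace Y" using F by (simp add: RC_def)
  have "closedin (subtopology W (h ` topspace Y)) (h ` F)"
    using homeomorphic_map_closedness[OF hom FY] RC_closedin[OF F] by blast
  then have "h ` topspace Y \<inter> W closure_of (h ` F) = h ` F"
    by (simp add: closedin_Int_closure_of)
  moreover have "inj_on h (topspace Y)"
    using hom homeomorphic_imp_injective_map by blast
  ultimately show ?thesis
    using y FY by (metis (no_types, lifting) Int_iff image_eqI inj_on_image_mem_iff)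
qed

lemma extension_le_grill_space:
  assumes ext: "extension_of Y W h" and semi: "semiregular_space W" and t0: "t0_space W"
  shows "ext_le_in Y W h (grill_space Y) (sigma_RC Y)"
proof -
  define k where "k w = {F \<in> RC Y. w \<in> W closure_of (h ` F)}" for w
  have gr: "grill_RC Y (k w)" if w: "w \<in> topspace W" for w
    unfolding grill_RC_def
  proof (intro conjI ballI impI)
    show "k w \<noteq> {}"
      using w ext RC_topspace unfolding k_def extension_of_def by fastforce
    show "\<And>a b. a \<in> k w \<Longrightarrow> b \<in> RC Y \<Longrightarrow> a \<subseteq> b \<Longrightarrow> b \<in> k w"
      unfolding k_def using closure_of_mono image_mono by (metis (no_types, lifting) mem_Collect_eq subsetD)
    show "\<And>a b. a \<in> RC Y \<Longrightarrow> b \<in> RC Y \<Longrightarrow> a \<union> b \<in> k w \<Longrightarrow> a \<in> k w \<or> b \<in> k w"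
      unfolding k_def by (auto simp: image_Un)
  qed (auto simp: k_def)
  have base: "\<exists>\<A>\<subseteq>RC Y. C = {w \<in> topspace W. \<A> \<subseteq> k w}" if C: "closedin W C" for C
  proof -
    obtain \<B> where \<B>: "\<B> \<subseteq> RC W" "C = topspace W \<inter> \<Inter>\<B>"
      using semi C unfolding semiregular_space_def closed_base_of_def by meson
    let ?A = "{F \<in> RC Y. W closure_of (h ` F) \<in> \<B>}"
    have "C = {w \<in> topspace W. ?A \<subseteq> k w}"
    proof (intro equalityI subsetI)
      fix w assume "w \<in> C"
      then show "w \<in> {w \<in> topspace W. ?A \<subseteq> k w}"
        using \<B> unfolding k_def by blast
    next
      fix w assume w: "w \<in> {w \<in> topspace W. ?A \<subseteq> k w}"
      have "w \<in> B" if B: "B \<in> \<B>" for B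
      proof -
        obtain F where "F \<in> RC Y" "B = W closure_of (h ` F)"
          using extension_RC[OF ext] B \<B>(1) by blast
        then show ?thesis using w B unfolding k_def by blast
      qed
      then show "w \<in> C" using w \<B>(2) by blast
    qed
    then show ?thesis by (intro exI[of _ ?A]) simp
  qed
  have cont: "continuous_map W (grill_space Y) k"
    unfolding continuous_map_closedin
  proof (intro conjI allI impI)
    show "k \<in> topspace W \<rightarrow> topspace (grill_space Y)"
      using gr by (auto simp: topspace_grill_space)
    fix C assume "closedin (grill_space Y) C"
    then obtain \<A> where \<A>: "\<A> \<subseteq> RC Y" "C = {\<Gamma>. grill_RC Y \<Gamma> \<and> \<A> \<subseteq> \<Gamma>}"
      by (rule closedin_grill_space)
    have "{w \<in> topspace W. k w \<in> C} = topspace W \<inter> \<Inter>((\<lambda>F. W closure_of (h ` F)) ` \<A>)"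
      using \<A> gr unfolding k_def by auto
    also have "closedin W \<dots>"
      by (cases "\<A> = {}") (auto intro!: closedin_Int closedin_Inter)
    finally show "closedin W {w \<in> topspace W. k w \<in> C}" .
  qed
  have inj: "inj_on k (topspace W)"
  proof (rule inj_onI, rule ccontr)
    fix v w assume vw: "v \<in> topspace W" "w \<in> topspace W" "k v = k w" "v \<noteq> w"
    then obtain C where "closedin W C" "v \<notin> C \<longleftrightarrow> w \<in> C"
      using t0 unfolding t0_space by meson
    moreover then obtain \<A> where "C = {w \<in> topspace W. \<A> \<subseteq> k w}" using base by blast
    ultimately show False using vw by auto
  qed
  have "closed_map W (subtopology (grill_space Y) (k ` topspace W)) k"
    unfolding closed_map_def
  proof (intro allI impI)
    fix C assume "closedin W C"
    then obtain \<A> where \<A>: "\<A> \<subseteq> RC Y" "C = {w \<in> topspace W. \<A> \<subseteq> k w}"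
      using base by blast
    let ?D = "topspace (grill_space Y) \<inter> \<Inter>((\<lambda>F. {\<Gamma>. grill_RC Y \<Gamma> \<and> F \<in> \<Gamma>}) ` \<A>)"
    have "closedin (grill_space Y) ?D"
      using \<A>(1) closedin_grill_basic
      by (cases "\<A> = {}") (auto intro!: closedin_Int closedin_Inter)
    moreover have "k ` C = ?D \<inter> k ` topspace W"
      using \<A>(2) gr by (auto simp: topspace_grill_space)
    ultimately show "closedin (subtopology (grill_space Y) (k ` topspace W)) (k ` C)"
      by (auto simp: closedin_subtopology)
  qed
  moreover have "continuous_map W (subtopology (grill_space Y) (k ` topspace W)) k"
    using cont by (simp add: continuous_map_in_subtopology)
  ultimately have "embedding_map W (subtopology (grill_space Y) (k ` topspace W)) k"
    using inj by (simp add: injective_closed_imp_embedding_map)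
  then have emb: "embedding_map W (grill_space Y) k"
    by (simp add: embedding_map_in_subtopology)
  have "k (h y) = sigma_RC Y y" if "y \<in> topspace Y" for y
    using extension_trace[OF ext _ that] unfolding k_def sigma_RC_def by blast
  with emb show ?thesis unfolding ext_le_in_def by blast
qed

lemma extension_id: "extension_of Y Y id"
  by (simp add: extension_of_def embedding_map_def)

lemma C_semiregular_extension_grill_space:
  assumes semi: "semiregular_space Y" and t0: "t0_space Y"
  shows "C_semiregular_extension Y (grill_space Y) (sigma_RC Y)"
proof -
  let ?G = "grill_space Y" and ?B = "\<lambda>F. {\<Gamma>. grill_RC Y \<Gamma> \<and> F \<in> \<Gamma>}"
  obtain k where "embedding_map Y ?G k" "\<forall>y\<in>topspace Y. k (id y) = sigma_RC Y y"
    using extension_le_grill_space[OF extension_id semi t0] unfolding ext_le_in_def by blast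
  then have emb: "embedding_map Y ?G (sigma_RC Y)"
    using embedding_map_eq[of Y ?G k "sigma_RC Y"] by simp
  have sgr: "grill_RC Y (sigma_RC Y y)" if "y \<in> topspace Y" for y
    using emb that unfolding embedding_map_def
    by (metis (no_types, lifting) Int_iff homeomorphic_imp_surjective_map image_eqI
        mem_Collect_eq topspace_grill_space topspace_subtopology)
  have cl: "?G closure_of (sigma_RC Y ` F) = ?B F" if F: "F \<in> RC Y" for F
  proof (rule closure_of_unique)
    have FY: "F \<subseteq> topspace Y" using F by (simp add: RC_def)
    show "sigma_RC Y ` F \<subseteq> ?B F"
      using FY F sgr by (auto simp: sigma_RC_def)
    show "closedin ?G (?B F)" using F by (rule closedin_grill_basic)
    fix C assume sub: "sigma_RC Y ` F \<subseteq> C" and C: "closedin ?G C"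
    from C obtain \<A> where \<A>: "\<A> \<subseteq> RC Y" "C = {\<Gamma>. grill_RC Y \<Gamma> \<and> \<A> \<subseteq> \<Gamma>}"
      by (rule closedin_grill_space)
    have "F \<subseteq> A" if "A \<in> \<A>" for A
      using sub \<A>(2) that unfolding sigma_RC_def by auto
    then have "A \<in> \<Gamma>" if "A \<in> \<A>" "grill_RC Y \<Gamma>" "F \<in> \<Gamma>" for A \<Gamma>
      using that \<A>(1) grill_up by (metis subsetD)
    then show "?B F \<subseteq> C" using \<A>(2) by blast
  qed
  have dense: "?G closure_of (sigma_RC Y ` topspace Y) = topspace ?G"
    unfolding cl[OF RC_topspace] topspace_grill_space using grill_topspace by blast
  have ext: "extension_of Y ?G (sigma_RC Y)"
    using emb dense by (simp add: extension_of_def)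
  have RCG: "RC ?G = ?B ` RC Y"
  proof (intro equalityI subsetI)
    fix A assume "A \<in> RC ?G"
    then obtain F where "F \<in> RC Y" "A = ?G closure_of (sigma_RC Y ` F)"
      using extension_RC[OF ext] by meson
    then show "A \<in> ?B ` RC Y" using cl by blast
  next
    fix A assume "A \<in> ?B ` RC Y"
    then obtain F where F: "F \<in> RC Y" "A = ?B F" by blast
    then show "A \<in> RC ?G"
      using extension_closure_RC[OF ext F(1)] cl[OF F(1)] by simp
  qed
  have "semiregular_space ?G"
    unfolding semiregular_space_def closed_base_of_def
  proof (intro conjI ballI allI impI)
    fix F assume "F \<in> RC ?G" then show "closedin ?G F" by (rule RC_closedin)
  next
    fix C assume "closedin ?G C"
    then obtain \<A> where \<A>: "\<A> \<subseteq> RC Y" "C = {\<Gamma>. grill_RC Y \<Gamma> \<and> \<A> \<subseteq> \<Gamma>}"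
      by (rule closedin_grill_space)
    have "C = topspace ?G \<inter> \<Inter>(?B ` \<A>)"
      unfolding \<A>(2) topspace_grill_space by auto
    moreover have "?B ` \<A> \<subseteq> RC ?G" using \<A>(1) RCG by blast
    ultimately show "\<exists>\<B>\<subseteq>RC ?G. C = topspace ?G \<inter> \<Inter>\<B>" by blast
  qed
  moreover have "t0_space ?G"
    unfolding t0_space
  proof (intro ballI impI)
    fix \<Gamma> \<Delta> assume g: "\<Gamma> \<in> topspace ?G" "\<Delta> \<in> topspace ?G" "\<Gamma> \<noteq> \<Delta>"
    then obtain F where "F \<in> RC Y" "F \<notin> \<Gamma> \<longleftrightarrow> F \<in> \<Delta>"
      using grill_subset unfolding topspace_grill_space by (metis mem_Collect_eq subset_antisym subsetD subsetI)
    then show "\<exists>C. closedin ?G C \<and> (\<Gamma> \<notin> C) = (\<Delta> \<in> C)"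
      using closedin_grill_basic[of F Y] g unfolding topspace_grill_space by blast
  qed
  moreover have "\<exists>x\<in>topspace ?G. \<Lambda> = sigma_RC ?G x" if \<Lambda>: "grill_RC ?G \<Lambda>" for \<Lambda>
  proof -
    define \<Gamma> where "\<Gamma> = {F \<in> RC Y. ?B F \<in> \<Lambda>}"
    have BRC: "?B F \<in> RC ?G" if "F \<in> RC Y" for F using that RCG by blast
    have "grill_RC Y \<Gamma>"
      unfolding grill_RC_def
    proof (intro conjI ballI impI)
      show "\<Gamma> \<subseteq> RC Y" unfolding \<Gamma>_def by blast
      have "\<Lambda> \<noteq> {}" "\<Lambda> \<subseteq> ?B ` RC Y"
        using grill_nonempty[OF \<Lambda>] grill_subset[OF \<Lambda>] unfolding RCG by blast+
      then show "\<Gamma> \<noteq> {}" unfolding \<Gamma>_def by blast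
      have "?B {} = {}" using grill_empty by blast
      with grill_empty[OF \<Lambda>] have "?B {} \<notin> \<Lambda>" by (simp only: not_False_eq_True)
      then show "{} \<notin> \<Gamma>" unfolding \<Gamma>_def by blast
    next
      fix a b assume ab: "a \<in> \<Gamma>" "b \<in> RC Y" "a \<subseteq> b"
      have "?B a \<subseteq> ?B b" using grill_up ab by blast
      moreover have "?B a \<in> \<Lambda>" using ab(1) unfolding \<Gamma>_def by simp
      ultimately have "?B b \<in> \<Lambda>"
        using grill_up[OF \<Lambda>] BRC[OF ab(2)] by metis
      then show "b \<in> \<Gamma>" using ab(2) unfolding \<Gamma>_def by simp
    next
      fix a b assume ab: "a \<in> RC Y" "b \<in> RC Y" "a \<union> b \<in> \<Gamma>"
      have "?B (a \<union> b) = ?B a \<union> ?B b"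
        using grill_Un_iff ab(1,2) by blast
      then have "?B a \<union> ?B b \<in> \<Lambda>" using ab(3) unfolding \<Gamma>_def by simp
      then have "?B a \<in> \<Lambda> \<or> ?B b \<in> \<Lambda>"
        using grill_Un_iff[OF \<Lambda> BRC[OF ab(1)] BRC[OF ab(2)]] by simp
      then show "a \<in> \<Gamma> \<or> b \<in> \<Gamma>" using ab unfolding \<Gamma>_def by blast
    qed
    moreover have "\<Lambda> \<subseteq> ?B ` RC Y"
      using grill_subset[OF \<Lambda>] unfolding RCG .
    ultimately have "\<Lambda> = sigma_RC ?G \<Gamma>"
      unfolding sigma_RC_def RCG \<Gamma>_def by blast
    then show ?thesis
      using \<open>grill_RC Y \<Gamma>\<close> topspace_grill_space by blast
  qed
  ultimately have "C_semiregular_space ?G"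
    unfolding C_semiregular_space_def by blast
  with ext show ?thesis by (simp add: C_semiregular_extension_def)
qed

lemma compact_Hausdorff_semiregular:
  assumes "compact_space Y" "Hausdorff_space Y"
  shows "semiregular_space Y"
  unfolding semiregular_space_def closed_base_of_def
proof (intro conjI ballI allI impI)
  fix F assume "F \<in> RC Y" then show "closedin Y F" by (rule RC_closedin)
next
  fix C assume C: "closedin Y C"
  have reg: "regular_space Y"
    using assms by (simp add: compact_Hausdorff_imp_regular_space)
  let ?A = "{F \<in> RC Y. C \<subseteq> F}"
  have "x \<in> C" if x: "x \<in> topspace Y" "x \<in> \<Inter>?A" for x
  proof (rule ccontr)
    assume "x \<notin> C"
    then obtain U V where UV: "openin Y U" "openin Y V" "x \<in> U" "C \<subseteq> V" "disjnt U V"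
      using reg C x(1) unfolding regular_space_def by (metis DiffI)
    have "C \<subseteq> Y closure_of V"
      using UV(4) closure_of_subset[OF openin_subset[OF UV(2)]] by (rule subset_trans)
    then have "x \<in> Y closure_of V"
      using x(2) RC_closure_open[OF UV(2)] by blast
    then show False
      using UV unfolding in_closure_of disjnt_def by blast
  qed
  then have "C = topspace Y \<inter> \<Inter>?A"
    using closedin_subset[OF C] by blast
  then show "\<exists>\<A>\<subseteq>RC Y. C = topspace Y \<inter> \<Inter>\<A>"
    by (intro exI[of _ ?A]) simp
qed

lemma is_gamma_grills:
  assumes "extremally_disconnected_space Y" "compact_space Y" "Hausdorff_space Y"
  shows "is_gamma Y (grill_space Y) (sigma_RC Y)"
  unfolding is_gamma_def
proof (intro conjI allI impI)
  show "C_semiregular_extension Y (grill_space Y) (sigma_RC Y)"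
    using assms compact_Hausdorff_semiregular Hausdorff_imp_t0_space
      C_semiregular_extension_grill_space by blast
next
  fix W :: "'a set set topology" and h
  assume "C_semiregular_extension Y W h"
  then show "ext_le_in Y W h (grill_space Y) (sigma_RC Y)"
    unfolding C_semiregular_extension_def C_semiregular_space_def
    using extension_le_grill_space by blast
qed

lemma is_gamma_largest:
  assumes "extremally_disconnected_space Y" "compact_space Y" "Hausdorff_space Y"
    and "is_gamma Y Z j" and "C_semiregular_extension Y W h"
  shows "ext_le_in Y W h Z j"
proof -
  have "ext_le_in Y W h (grill_space Y) (sigma_RC Y)"
    using assms(5) unfolding C_semiregular_extension_def C_semiregular_space_def
    using extension_le_grill_space by blast
  then obtain k1 where k1: "embedding_map W (grill_space Y) k1"
      "\<forall>y\<in>topspace Y. k1 (h y) = sigma_RC Y y"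
    unfolding ext_le_in_def by blast
  have "ext_le_in Y (grill_space Y) (sigma_RC Y) Z j"
    using assms is_gamma_grills unfolding is_gamma_def by blast
  then obtain k2 where k2: "embedding_map (grill_space Y) Z k2"
      "\<forall>y\<in>topspace Y. k2 (sigma_RC Y y) = j y"
    unfolding ext_le_in_def by blast
  have "embedding_map W Z (k2 \<circ> k1)"
    using k1 k2 embedding_map_compose by blast
  then show ?thesis
    unfolding ext_le_in_def using k1(2) k2(2) by (intro exI[of _ "k2 \<circ> k1"]) auto
qed

end

(* In an extremally disconnected space the regular closed sets are the clopen ones, so preimages
   under a continuous map f : X -> Y send RC Y to RC X and preserve finite unions. Hence for every
   point w of an extension (W, c) of X the family of all G in RC Y with w in the closure of
   c (f^-1 G) is a grill of RC Y, and w |-> this grill is a continuous map into the space of grills.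
   That space embeds into gamma Y because gamma Y is the largest C-semiregular extension. *)
theory Submission
  imports Defs
begin

text \<open>A regular closed set is the closure of its open interior, hence open here. Conversely, a
  clopen set is the closure of itself as an open set.\<close>

lemma RC_extremally_disconnected_iff_clopen:
  assumes "extremally_disconnected_space Y"
  shows "F \<in> RC Y \<longleftrightarrow> openin Y F \<and> closedin Y F"
proof
  assume F: "F \<in> RC Y"
  have "openin Y (Y closure_of (Y interior_of F))"
    using assms unfolding extremally_disconnected_space_def by simp
  then show "openin Y F \<and> closedin Y F"
    using F RC_closedin[OF F] by (simp add: RC_def)
next
  assume "openin Y F \<and> closedin Y F"
  then show "F \<in> RC Y"
    by (metis RC_closure_open closure_of_closedin)
qed

text \<open>Members of \<open>RC Y\<close> are clopen, continuity pulls clopen sets back to clopen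
  sets, and these are regular closed in any space.\<close>

lemma RC_preimage:
  assumes "extremally_disconnected_space Y" "continuous_map X Y f" "G \<in> RC Y"
  shows "{x \<in> topspace X. f x \<in> G} \<in> RC X"
proof -
  have "openin Y G" "closedin Y G"
    using assms by (simp_all add: RC_extremally_disconnected_iff_clopen)
  then have "openin X {x \<in> topspace X. f x \<in> G}" "closedin X {x \<in> topspace X. f x \<in> G}"
    using assms(2) openin_continuous_map_preimage closedin_continuous_map_preimage by blast+
  then show ?thesis
    by (metis RC_closure_open closure_of_closedin)
qed

text \<open>The map \<open>k\<close> follows the pattern of the embedding in
  \<open>extension_le_grill_space\<close>, with a regular closed set of \<open>X\<close> replaced by
  the preimage \<open>P G\<close> of some \<open>G\<close> in \<open>RC Y\<close>.\<close>

lemma continuous_map_extends_to_grill_space: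
  assumes ext: "extension_of X W c" and ed: "extremally_disconnected_space Y"
    and f: "continuous_map X Y f"
  obtains k where "continuous_map W (grill_space Y) k"
    "\<And>x. x \<in> topspace X \<Longrightarrow> k (c x) = sigma_RC Y (f x)"
proof -
  define P where "P G = {x \<in> topspace X. f x \<in> G}" for G
  define k where "k w = {G \<in> RC Y. w \<in> W closure_of (c ` P G)}" for w
  have P_RC: "P G \<in> RC X" if "G \<in> RC Y" for G
    using RC_preimage[OF ed f that] by (simp add: P_def)
  have P_top: "P (topspace Y) = topspace X"
    using f continuous_map_funspace unfolding P_def by fastforce
  have P_mono: "P G \<subseteq> P H" if "G \<subseteq> H" for G H
    using that unfolding P_def by blast
  have P_Un: "P (G \<union> H) = P G \<union> P H" for G H
    unfolding P_def by blast
  have P_empty: "P {} = {}"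
    by (simp add: P_def)
  have gr: "grill_RC Y (k w)" if w: "w \<in> topspace W" for w
    unfolding grill_RC_def
  proof (intro conjI ballI impI)
    show "k w \<subseteq> RC Y" by (auto simp: k_def)
    have "topspace Y \<in> k w"
      using ext w unfolding k_def extension_of_def by (simp add: P_top RC_topspace)
    then show "k w \<noteq> {}" by blast
    show "{} \<notin> k w" by (simp add: k_def P_empty)
  next
    fix a b assume ab: "a \<in> k w" "b \<in> RC Y" "a \<subseteq> b"
    have "W closure_of (c ` P a) \<subseteq> W closure_of (c ` P b)"
      by (intro closure_of_mono image_mono P_mono ab)
    then show "b \<in> k w" using ab by (auto simp: k_def)
  next
    fix a b assume "a \<in> RC Y" "b \<in> RC Y" "a \<union> b \<in> k w"
    \<comment> \<open>Preimage, image and closure all commute with binary unions.\<close>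
    then show "a \<in> k w \<or> b \<in> k w"
      by (auto simp: k_def P_Un image_Un)
  qed
  have "continuous_map W (grill_space Y) k"
    unfolding continuous_map_closedin
  proof (intro conjI allI impI)
    show "k \<in> topspace W \<rightarrow> topspace (grill_space Y)"
      using gr by (auto simp: topspace_grill_space)
    fix C assume "closedin (grill_space Y) C"
    then obtain \<A> where \<A>: "\<A> \<subseteq> RC Y" "C = {\<Gamma>. grill_RC Y \<Gamma> \<and> \<A> \<subseteq> \<Gamma>}"
      by (rule closedin_grill_space)
    have "{w \<in> topspace W. k w \<in> C} = topspace W \<inter> \<Inter>((\<lambda>G. W closure_of (c ` P G)) ` \<A>)"
      using \<A> gr unfolding k_def by auto
    also have "closedin W \<dots>"
      \<comment> \<open>The empty family is separate: its intersection is \<open>UNIV\<close>, which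
        leaves \<open>topspace W\<close>.\<close>
      by (cases "\<A> = {}") (auto intro!: closedin_Int closedin_Inter)
    finally show "closedin W {w \<in> topspace W. k w \<in> C}" .
  qed
  moreover have "k (c x) = sigma_RC Y (f x)" if "x \<in> topspace X" for x
    using extension_trace[OF ext P_RC that] that by (auto simp: k_def sigma_RC_def P_def)
  ultimately show thesis by (rule that)
qed

lemma continuous_map_extends_to_gamma:
  assumes Y: "extremally_disconnected_space Y" "compact_space Y" "Hausdorff_space Y"
    and gamma: "is_gamma Y gY jY"
    and ext: "C_semiregular_extension X W c" and f: "continuous_map X Y f"
  shows "\<exists>f'. continuous_map W gY f' \<and> (\<forall>x\<in>topspace X. jY (f x) = f' (c x))"
proof -
  obtain k where k: "continuous_map W (grill_space Y) k"
      "\<And>x. x \<in> topspace X \<Longrightarrow> k (c x) = sigma_RC Y (f x)"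
    using continuous_map_extends_to_grill_space[OF _ Y(1) f] ext
    unfolding C_semiregular_extension_def by blast
  \<comment> \<open>The grill space is itself a C-semiregular extension of \<open>Y\<close>, so it
    lies below the largest one.\<close>
  have "ext_le_in Y (grill_space Y) (sigma_RC Y) gY jY"
    using is_gamma_largest[OF Y gamma] is_gamma_grills[OF Y] unfolding is_gamma_def by blast
  then obtain e where e: "embedding_map (grill_space Y) gY e"
      "\<forall>y\<in>topspace Y. e (sigma_RC Y y) = jY y"
    unfolding ext_le_in_def by blast
  have "continuous_map (grill_space Y) gY e"
    using e(1) unfolding embedding_map_def
    by (meson continuous_map_in_subtopology homeomorphic_imp_continuous_map)
  then have "continuous_map W gY (e \<circ> k)"
    using k(1) continuous_map_compose by blast
  moreover have "f x \<in> topspace Y" if "x \<in> topspace X" for x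
    using f that continuous_map_funspace by fastforce
  ultimately show ?thesis
    using k(2) e(2) by (intro exI[of _ "e \<circ> k"]) simp
qed

theorem theorem9p6:
  fixes X :: "'a topology" and Y :: "'b topology"
    and gY :: "'c topology" and jY :: "'b \<Rightarrow> 'c"
  assumes "extremally_disconnected_space X" "compact_space X" "Hausdorff_space X"
    and "extremally_disconnected_space Y" "compact_space Y" "Hausdorff_space Y"
    and "is_gamma Y gY jY"
  shows "(\<forall>(cX :: 'd topology) c f.
            C_semiregular_extension X cX c \<and> continuous_map X Y f \<longrightarrow>
            (\<exists>f'. continuous_map cX gY f' \<and> (\<forall>x\<in>topspace X. jY (f x) = f' (c x)))) \<and>
         (\<forall>(gX :: 'e topology) jX f.
            is_gamma X gX jX \<and> continuous_map X Y f \<longrightarrow>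
            (\<exists>gf. continuous_map gX gY gf \<and> (\<forall>x\<in>topspace X. jY (f x) = gf (jX x))))"
  \<comment> \<open>The second half is the first for \<open>gX\<close> and \<open>jX\<close>, since
    \<open>is_gamma\<close> includes being a C-semiregular extension.\<close>
  by (intro conjI allI impI continuous_map_extends_to_gamma[OF assms(4-7)])
    (simp_all add: is_gamma_def)

end
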